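(* Let $v_0,v_1,\dots,v_n$ be linearly independent vectors in a real inner product space. For $1\le k\le n$ let $V_k=\mathrm{Span}\{v_0,\dots,v_k\}$, oriented so that the ordered basis $(v_0,v_1,\dots,v_k)$ is positive, and let $\ast$ be the Hodge star operator of $V_k$. Then $$\ast(v_0\wedge v_1\wedge\cdots\wedge v_{k-1})=\frac{1}{\sqrt{d_{k+1,k+1}}}\begin{vmatrix}\langle v_0,v_0\rangle&\langle v_1,v_0\rangle&\cdots&\langle v_k,v_0\rangle\\ \langle v_0,v_1\rangle&\langle v_1,v_1\rangle&\cdots&\langle v_k,v_1\rangle\\ \vdots&\vdots&\ddots&\vdots\\ \langle v_0,v_{k-1}\rangle&\langle v_1,v_{k-1}\rangle&\cdots&\langle v_k,v_{k-1}\rangle\\ v_0&v_1&\cdots&v_k\end{vmatrix}.$$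
   Context: The determinant, whose last row consists of vectors, is understood as the vector obtained by formal cofactor expansion along the last row. $d_{k+1,k+1}=\det(\langle v_i,v_j\rangle)_{0\le i,j\le k}$ is the Gram determinant of $v_0,\dots,v_k$. For an $m$-dimensional oriented real inner product space $W$, the inner product is extended to $\wedge^p W$ by $\langle w_1\wedge\cdots\wedge w_p,\,w_1'\wedge\cdots\wedge w_p'\rangle=\det(\langle w_i,w_j'\rangle)_{1\le i,j\le p}$, and the Hodge star operator $\ast:\wedge^pW\to\wedge^{m-p}W$ is determined by $\langle\ast\alpha,\beta\rangle\,\Omega=\alpha\wedge\beta$ for all $\alpha\in\wedge^pW$, $\beta\in\wedge^{m-p}W$, where $\Omega\in\wedge^mW$ is the volume form associated with the inner product and orientation (the unit vector of $\wedge^m W$ that is positive for the orientation). Here $\wedge^1W=W$. *)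

theory Defs
  imports
    "HOL-Analysis.Inner_Product"
    "HOL-Library.Poly_Mapping"
    "Jordan_Normal_Form.Determinant"
begin

section \<open>The exterior algebra of a real vector space\<close>

text \<open>
  The free associative real algebra on the elements of a vector space \<open>'a\<close> consists of the
  finitely supported real functions on the free monoid over \<open>'a\<close>; its product is the convolution
  product that \<^theory>\<open>HOL-Library.Poly_Mapping\<close> provides.  The exterior algebra is its
  quotient by the two-sided ideal generated by the relations that make the inclusion of \<open>'a\<close>
  linear and the relations \<open>x x = 0\<close>.
\<close>

datatype 'a monomial = Monomial (factors: "'a list")

instantiation monomial :: (type) monoid_add
begin
definition zero_monomial :: "'a monomial" where "zero_monomial = Monomial []"
definition plus_monomial :: "'a monomial \<Rightarrow> 'a monomial \<Rightarrow> 'a monomial"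
  where "plus_monomial u w = Monomial (factors u @ factors w)"
instance
  by standard (simp_all add: zero_monomial_def plus_monomial_def)
end

type_synonym 'a free_algebra = "'a monomial \<Rightarrow>\<^sub>0 real"

definition free_gen :: "'a \<Rightarrow> 'a free_algebra"
  where "free_gen x = Poly_Mapping.single (Monomial [x]) 1"

definition free_const :: "real \<Rightarrow> 'a free_algebra"
  where "free_const c = Poly_Mapping.single 0 c"

inductive_set ext_relators :: "'a::real_vector free_algebra set" where
  add: "free_gen (x + y) - free_gen x - free_gen y \<in> ext_relators"
| scale: "free_gen (c *\<^sub>R x) - free_const c * free_gen x \<in> ext_relators"
| square: "free_gen x * free_gen x \<in> ext_relators"

inductive_set ext_ideal :: "'a::real_vector free_algebra set" where
  zero: "0 \<in> ext_ideal"
| gen: "r \<in> ext_relators \<Longrightarrow> f * r * g \<in> ext_ideal"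
| add: "f \<in> ext_ideal \<Longrightarrow> g \<in> ext_ideal \<Longrightarrow> f + g \<in> ext_ideal"

lemma ext_ideal_mult:
  assumes "r \<in> ext_ideal" shows "f * r * g \<in> ext_ideal"
  using assms
proof induction
  case (gen r f' g')
  have "f * (f' * r * g') * g = (f * f') * r * (g' * g)" by (simp add: mult.assoc)
  then show ?case using ext_ideal.gen[OF gen] by metis
qed (auto simp: distrib_left distrib_right intro: ext_ideal.intros)

lemma ext_ideal_mult_left: "r \<in> ext_ideal \<Longrightarrow> f * r \<in> ext_ideal"
  using ext_ideal_mult[of r f 1] by simp

lemma ext_ideal_mult_right: "r \<in> ext_ideal \<Longrightarrow> r * g \<in> ext_ideal"
  using ext_ideal_mult[of r 1 g] by simp

lemma ext_ideal_uminus: "r \<in> ext_ideal \<Longrightarrow> - r \<in> ext_ideal"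
  using ext_ideal_mult_left[of r "-1"] by simp

lemma ext_ideal_diff: "r \<in> ext_ideal \<Longrightarrow> s \<in> ext_ideal \<Longrightarrow> r - s \<in> ext_ideal"
  using ext_ideal.add[of r "- s"] ext_ideal_uminus[of s] by simp

lemma ext_relators_ideal: "r \<in> ext_relators \<Longrightarrow> r \<in> ext_ideal"
  using ext_ideal.gen[of r 1 1] by simp

definition ext_rel :: "'a::real_vector free_algebra \<Rightarrow> 'a free_algebra \<Rightarrow> bool"
  where "ext_rel f g \<longleftrightarrow> f - g \<in> ext_ideal"

lemma equivp_ext_rel: "equivp (ext_rel :: 'a::real_vector free_algebra \<Rightarrow> _)"
proof (rule equivpI)
  show "reflp (ext_rel :: 'a free_algebra \<Rightarrow> _)" by (simp add: reflp_def ext_rel_def ext_ideal.zero)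
  show "symp (ext_rel :: 'a free_algebra \<Rightarrow> _)"
    unfolding symp_def ext_rel_def using ext_ideal_uminus by (metis minus_diff_eq)
  show "transp (ext_rel :: 'a free_algebra \<Rightarrow> _)"
  proof (rule transpI)
    fix f g h :: "'a free_algebra"
    assume "ext_rel f g" "ext_rel g h"
    then have "(f - g) + (g - h) \<in> ext_ideal" unfolding ext_rel_def by (rule ext_ideal.add)
    then show "ext_rel f h" by (simp add: ext_rel_def)
  qed
qed


subsection \<open>Extending functions linearly from monomials to the free algebra\<close>

definition free_extend :: "('a monomial \<Rightarrow> real) \<Rightarrow> 'a free_algebra \<Rightarrow> real"
  where "free_extend \<phi> f =
    (\<Sum>u\<in>Poly_Mapping.keys f. Poly_Mapping.lookup f u * \<phi> u)"

lemma free_extend_superset: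
  assumes "finite S" "Poly_Mapping.keys f \<subseteq> S"
  shows "free_extend \<phi> f = (\<Sum>u\<in>S. Poly_Mapping.lookup f u * \<phi> u)"
  unfolding free_extend_def
  by (rule sum.mono_neutral_left) (use assms in \<open>auto simp: in_keys_iff\<close>)

lemma free_extend_add: "free_extend \<phi> (f + g) = free_extend \<phi> f + free_extend \<phi> g"
proof -
  let ?S = "Poly_Mapping.keys f \<union> Poly_Mapping.keys g"
  have "finite ?S" by simp
  then show ?thesis
    using free_extend_superset[of ?S "f + g" \<phi>] free_extend_superset[of ?S f \<phi>]
      free_extend_superset[of ?S g \<phi>] Poly_Mapping.keys_add[of f g]
    by (simp add: lookup_add distrib_right sum.distrib)
qed

lemma free_extend_0 [simp]: "free_extend \<phi> 0 = 0"
  by (simp add: free_extend_def)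

lemma free_extend_diff: "free_extend \<phi> (f - g) = free_extend \<phi> f - free_extend \<phi> g"
  using free_extend_add[of \<phi> "f - g" g] by simp

lemma free_extend_single [simp]: "free_extend \<phi> (Poly_Mapping.single u c) = c * \<phi> u"
  by (simp add: free_extend_def)

lemma free_extend_fun_scale: "free_extend (\<lambda>u. c * \<phi> u) f = c * free_extend \<phi> f"
  by (simp add: free_extend_def sum_distrib_left algebra_simps)

lemma free_extend_fun_0: "free_extend (\<lambda>u. 0) f = 0"
  by (simp add: free_extend_def)

lemma free_algebra_induct [case_names zero single add]:
  fixes f :: "'a free_algebra"
  assumes "P 0" "\<And>u c. P (Poly_Mapping.single u c)" "\<And>f g. P f \<Longrightarrow> P g \<Longrightarrow> P (f + g)"
  shows "P f"
proof -
  have "P (\<Sum>u\<in>S. Poly_Mapping.single u (Poly_Mapping.lookup f u))" if "finite S" for S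
    using that by induction (auto intro: assms)
  moreover have "f = (\<Sum>u\<in>Poly_Mapping.keys f. Poly_Mapping.single u (Poly_Mapping.lookup f u))"
    by (rule poly_mapping_eqI) (simp add: lookup_sum lookup_single when_def in_keys_iff)
  ultimately show ?thesis using finite_keys by metis
qed

lemma free_extend_const_mult: "free_extend \<phi> (free_const c * f) = c * free_extend \<phi> f"
  by (induction f rule: free_algebra_induct)
    (auto simp: free_const_def mult_single distrib_left free_extend_add)

definition alternating_on_monomials :: "('a::real_vector monomial \<Rightarrow> real) \<Rightarrow> bool"
  where "alternating_on_monomials \<phi> \<longleftrightarrow>
    (\<forall>us ws x y. \<phi> (Monomial (us @ (x + y) # ws)) =
       \<phi> (Monomial (us @ x # ws)) + \<phi> (Monomial (us @ y # ws))) \<and>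
    (\<forall>us ws c x. \<phi> (Monomial (us @ (c *\<^sub>R x) # ws)) = c * \<phi> (Monomial (us @ x # ws))) \<and>
    (\<forall>us ws x. \<phi> (Monomial (us @ x # x # ws)) = 0)"

lemma free_extend_ideal:
  assumes \<phi>: "alternating_on_monomials \<phi>" and "f \<in> ext_ideal"
  shows "free_extend \<phi> f = 0"
  using assms(2)
proof induction
  case (gen r f g)
  have mono: "free_extend \<phi> (Poly_Mapping.single (Monomial us) a * r *
      Poly_Mapping.single (Monomial ws) b) = 0" for us ws a b
    using gen
  proof cases
    case (add x y)
    show ?thesis
      using \<phi> unfolding add alternating_on_monomials_def
      by (simp add: free_gen_def left_diff_distrib right_diff_distrib mult_single
          plus_monomial_def free_extend_diff free_extend_add algebra_simps)
  next
    case (scale c x)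
    show ?thesis
      using \<phi> unfolding scale alternating_on_monomials_def
      by (simp add: free_gen_def free_const_def left_diff_distrib right_diff_distrib mult_single
          plus_monomial_def zero_monomial_def free_extend_diff free_extend_add algebra_simps)
  next
    case (square x)
    show ?thesis
      using \<phi> unfolding square alternating_on_monomials_def
      by (simp add: free_gen_def mult_single plus_monomial_def)
  qed
  have left: "free_extend \<phi> (f * r * Poly_Mapping.single (Monomial ws) b) = 0" for ws b
    by (induction f rule: free_algebra_induct)
      (use mono in \<open>auto simp: distrib_right free_extend_add, metis monomial.exhaust\<close>)
  show ?case
    by (induction g rule: free_algebra_induct)
      (use left in \<open>auto simp: distrib_left free_extend_add, metis monomial.exhaust\<close>)
qed (auto simp: free_extend_add)

lemma one_notin_ext_ideal: "1 \<notin> ext_ideal"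
proof
  assume *: "1 \<in> (ext_ideal :: 'a free_algebra set)"
  let ?\<phi> = "\<lambda>u :: 'a monomial. if factors u = [] then 1 else 0"
  have "alternating_on_monomials ?\<phi>" by (simp add: alternating_on_monomials_def)
  from free_extend_ideal[OF this *] have "free_extend ?\<phi> (Poly_Mapping.single 0 1) = 0" by simp
  then show False by (simp only: free_extend_single) (simp add: zero_monomial_def)
qed


subsection \<open>The quotient algebra\<close>

quotient_type (overloaded) 'a exterior = "'a::real_vector free_algebra" / ext_rel
  by (rule equivp_ext_rel)

lemma free_const_commute: "free_const c * f = f * free_const c"
  by (induction f rule: free_algebra_induct)
    (auto simp: free_const_def mult_single distrib_left distrib_right mult.commute)

text \<open>The product \<open>*\<close> of the exterior algebra is the wedge product.\<close>

instantiation exterior :: (real_vector) "{zero, one, plus, uminus, minus, times, scaleR}"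
begin

lift_definition zero_exterior :: "'a exterior" is 0 .
lift_definition one_exterior :: "'a exterior" is 1 .

lift_definition plus_exterior :: "'a exterior \<Rightarrow> 'a exterior \<Rightarrow> 'a exterior" is "(+)"
proof -
  fix f f' g g' :: "'a free_algebra"
  assume "ext_rel f f'" "ext_rel g g'"
  then have "(f - f') + (g - g') \<in> ext_ideal" unfolding ext_rel_def by (rule ext_ideal.add)
  then show "ext_rel (f + g) (f' + g')" unfolding ext_rel_def by (simp add: algebra_simps)
qed

lift_definition uminus_exterior :: "'a exterior \<Rightarrow> 'a exterior" is uminus
  unfolding ext_rel_def using ext_ideal_uminus by fastforce

lift_definition minus_exterior :: "'a exterior \<Rightarrow> 'a exterior \<Rightarrow> 'a exterior" is "(-)"
proof -
  fix f f' g g' :: "'a free_algebra"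
  assume "ext_rel f f'" "ext_rel g g'"
  then have "(f - f') - (g - g') \<in> ext_ideal" unfolding ext_rel_def by (rule ext_ideal_diff)
  then show "ext_rel (f - g) (f' - g')" unfolding ext_rel_def by (simp add: algebra_simps)
qed

lift_definition times_exterior :: "'a exterior \<Rightarrow> 'a exterior \<Rightarrow> 'a exterior" is "(*)"
proof -
  fix f f' g g' :: "'a free_algebra"
  assume "ext_rel f f'" "ext_rel g g'"
  then have "(f - f') * g + f' * (g - g') \<in> ext_ideal"
    unfolding ext_rel_def
    by (intro ext_ideal.add ext_ideal_mult_left ext_ideal_mult_right)
  then show "ext_rel (f * g) (f' * g')" unfolding ext_rel_def by (simp add: algebra_simps)
qed

lift_definition scaleR_exterior :: "real \<Rightarrow> 'a exterior \<Rightarrow> 'a exterior"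
  is "\<lambda>c f. free_const c * f"
  unfolding ext_rel_def using ext_ideal_mult_left by (metis right_diff_distrib)

instance ..

end

lemma ext_rel_refl [simp]: "ext_rel f f"
  by (simp add: ext_rel_def ext_ideal.zero)

instance exterior :: (real_vector) real_algebra_1
proof
  fix x y z :: "'a exterior" and a b :: real
  show "x + y + z = x + (y + z)" by transfer (simp add: add.assoc)
  show "x + y = y + x" by transfer (simp add: add.commute)
  show "0 + x = x" by transfer simp
  show "- x + x = 0" by transfer simp
  show "x - y = x + - y" by transfer simp
  show "x * y * z = x * (y * z)" by transfer (simp add: mult.assoc)
  show "1 * x = x" by transfer simp
  show "x * 1 = x" by transfer simp
  show "(x + y) * z = x * z + y * z" by transfer (simp add: distrib_right)
  show "x * (y + z) = x * y + x * z" by transfer (simp add: distrib_left)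
  show "(0 :: 'a exterior) \<noteq> 1"
    by transfer (use one_notin_ext_ideal ext_ideal_uminus in \<open>fastforce simp: ext_rel_def\<close>)
  show "a *\<^sub>R (x + y) = a *\<^sub>R x + a *\<^sub>R y" by transfer (simp add: distrib_left)
  show "(a + b) *\<^sub>R x = a *\<^sub>R x + b *\<^sub>R x"
    by transfer (simp add: free_const_def single_add distrib_right)
  show "a *\<^sub>R b *\<^sub>R x = (a * b) *\<^sub>R x"
    by transfer (simp add: free_const_def mult_single flip: mult.assoc)
  show "1 *\<^sub>R x = x" by transfer (simp add: free_const_def)
  show "a *\<^sub>R x * y = a *\<^sub>R (x * y)" by transfer (simp add: mult.assoc)
  show "x * a *\<^sub>R y = a *\<^sub>R (x * y)"
    by transfer (metis ext_rel_refl free_const_commute mult.assoc)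
qed

lift_definition ext_vec :: "'a::real_vector \<Rightarrow> 'a exterior" is free_gen .

definition ext_wedge :: "'a::real_vector list \<Rightarrow> 'a exterior"
  where "ext_wedge ws = prod_list (map ext_vec ws)"

lemma linear_ext_vec: "linear ext_vec"
proof (rule linearI)
  show "ext_vec (x + y) = ext_vec x + ext_vec y" for x y :: 'a
    by transfer (use ext_relators_ideal[OF ext_relators.add] in
        \<open>simp add: ext_rel_def diff_diff_eq\<close>)
  show "ext_vec (c *\<^sub>R x) = c *\<^sub>R ext_vec x" for c and x :: 'a
    by transfer (simp add: ext_rel_def ext_relators_ideal ext_relators.scale)
qed

lemma ext_vec_square: "ext_vec x * ext_vec x = 0"
  by transfer (simp add: ext_rel_def ext_relators_ideal ext_relators.square)

text \<open>
  The \<open>p\<close>-th exterior power of a subspace \<open>W\<close>, as a subspace of the exterior algebra of the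
  ambient space; the map on exterior powers induced by the inclusion of \<open>W\<close> is injective.  In particular \<open>\<and>\<^sup>1 W\<close> is \<open>ext_vec ` W\<close>, and \<open>ext_vec\<close> is the identification of
  \<open>W\<close> with \<open>\<and>\<^sup>1 W\<close>.
\<close>

definition ext_power :: "nat \<Rightarrow> 'a::real_vector set \<Rightarrow> 'a exterior set"
  where "ext_power p W = span {ext_wedge ws |ws. length ws = p \<and> set ws \<subseteq> W}"

lemma ext_power_1:
  assumes "subspace W" shows "ext_power 1 W = ext_vec ` W"
proof -
  have "{ext_wedge ws |ws. length ws = 1 \<and> set ws \<subseteq> W} = ext_vec ` W"
    by (auto simp: ext_wedge_def length_Suc_conv intro!: exI[of _ "[_]"])
  then show ?thesis
    using assms by (simp add: ext_power_def linear_ext_vec linear_subspace_image span_eq_iff)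
qed


section \<open>The inner product on the exterior algebra\<close>

definition gram :: "'a::real_inner list \<Rightarrow> 'a list \<Rightarrow> real mat"
  where "gram us ws = mat (length us) (length ws) (\<lambda>(i, j). inner (us ! i) (ws ! j))"

text \<open>Exterior powers of different degrees are taken to be orthogonal to each other.\<close>

definition monomial_inner :: "'a::real_inner monomial \<Rightarrow> 'a monomial \<Rightarrow> real"
  where "monomial_inner u w =
    (if length (factors u) = length (factors w) then det (gram (factors u) (factors w)) else 0)"

lemma monomial_inner_commute: "monomial_inner u w = monomial_inner w u"
proof (cases "length (factors u) = length (factors w)")
  case True
  have "transpose_mat (gram (factors u) (factors w)) = gram (factors w) (factors u)"
    by (rule eq_matI) (auto simp: gram_def inner_commute)
  moreover have "gram (factors u) (factors w) \<in>
      carrier_mat (length (factors u)) (length (factors u))"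
    using True by (simp add: gram_def)
  ultimately show ?thesis
    using True det_transpose by (metis monomial_inner_def)
qed (simp add: monomial_inner_def)

lemma det_expand_row:
  assumes A: "(A :: real mat) \<in> carrier_mat n n" and B: "B \<in> carrier_mat n n" and i: "i < n"
    and eq: "\<And>i' j'. i' < n \<Longrightarrow> j' < n \<Longrightarrow> i' \<noteq> i \<Longrightarrow> A $$ (i', j') = B $$ (i', j')"
  shows "det A = (\<Sum>j<n. A $$ (i, j) * cofactor B i j)"
proof -
  have "mat_delete A i j = mat_delete B i j" if "j < n" for j
    unfolding mat_delete_def by (rule cong_mat) (use A B i that in \<open>auto intro!: eq\<close>)
  then have "(\<Sum>j<n. A $$ (i, j) * cofactor A i j) = (\<Sum>j<n. A $$ (i, j) * cofactor B i j)"
    by (intro sum.cong) (simp_all add: cofactor_def)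
  then show ?thesis
    using laplace_expansion_row[OF A i] by simp
qed

lemma det_gram_row:
  assumes len: "length us + length vs + 1 = length ws"
  shows "det (gram (us @ x # vs) ws) =
    (\<Sum>j<length ws. inner x (ws ! j) * cofactor (gram (us @ 0 # vs) ws) (length us) j)"
proof -
  have len': "length (us @ z # vs) = length ws" for z
    using len by simp
  have carrier: "gram (us @ z # vs) ws \<in> carrier_mat (length ws) (length ws)" for z
    unfolding gram_def len' by (rule mat_carrier)
  have "det (gram (us @ x # vs) ws) = (\<Sum>j<length ws.
      gram (us @ x # vs) ws $$ (length us, j) * cofactor (gram (us @ 0 # vs) ws) (length us) j)"
  proof (rule det_expand_row[OF carrier carrier])
    show "length us < length ws" using len by linarith
    fix i' j'
    assume *: "i' < length ws" "j' < length ws" "i' \<noteq> length us"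
    have "(us @ x # vs) ! i' = (us @ 0 # vs) ! i'"
      using *(3) by (simp add: nth_append nth_Cons')
    then show "gram (us @ x # vs) ws $$ (i', j') = gram (us @ 0 # vs) ws $$ (i', j')"
      unfolding gram_def len' using *(1,2) by simp
  qed
  also have "\<dots> = (\<Sum>j<length ws.
      inner x (ws ! j) * cofactor (gram (us @ 0 # vs) ws) (length us) j)"
  proof (rule sum.cong)
    fix j assume "j \<in> {..<length ws}"
    moreover have "length us < length ws" using len by linarith
    ultimately show "gram (us @ x # vs) ws $$ (length us, j) *
          cofactor (gram (us @ 0 # vs) ws) (length us) j =
        inner x (ws ! j) * cofactor (gram (us @ 0 # vs) ws) (length us) j"
      unfolding gram_def len' by simp
  qed simp
  finally show ?thesis .
qed

lemma alternating_monomial_inner: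
  "alternating_on_monomials (\<lambda>u. monomial_inner u w)"
  unfolding alternating_on_monomials_def
proof (intro conjI allI)
  fix us ws :: "'a list" and x y :: 'a and c :: real
  have expand: "monomial_inner (Monomial (us @ z # ws)) w =
      (\<Sum>j<length (factors w). inner z (factors w ! j) *
        cofactor (gram (us @ 0 # ws) (factors w)) (length us) j)"
    if "length us + length ws + 1 = length (factors w)" for z
    using that det_gram_row[OF that, of z] unfolding monomial_inner_def by simp
  have vanish: "monomial_inner (Monomial (us @ z # ws)) w = 0"
    if "length us + length ws + 1 \<noteq> length (factors w)" for z
    using that by (simp add: monomial_inner_def)
  show "monomial_inner (Monomial (us @ (x + y) # ws)) w =
      monomial_inner (Monomial (us @ x # ws)) w + monomial_inner (Monomial (us @ y # ws)) w"
  proof (cases "length us + length ws + 1 = length (factors w)")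
    case True
    show ?thesis
      unfolding expand[OF True] by (simp only: inner_add_left distrib_right sum.distrib)
  qed (simp add: vanish)
  show "monomial_inner (Monomial (us @ (c *\<^sub>R x) # ws)) w =
      c * monomial_inner (Monomial (us @ x # ws)) w"
  proof (cases "length us + length ws + 1 = length (factors w)")
    case True
    show ?thesis
      unfolding expand[OF True]
      by (simp only: inner_scaleR_left sum_distrib_left mult.assoc)
  qed (simp add: vanish)
  show "monomial_inner (Monomial (us @ x # x # ws)) w = 0"
  proof (cases "length (us @ x # x # ws) = length (factors w)")
    case True
    let ?A = "gram (us @ x # x # ws) (factors w)"
    have "?A \<in> carrier_mat (length (us @ x # x # ws)) (length (us @ x # x # ws))"
      unfolding gram_def True by (rule mat_carrier)
    moreover have "row ?A (length us) = row ?A (Suc (length us))"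
      by (rule eq_vecI) (simp_all add: gram_def nth_append)
    ultimately have "det ?A = 0"
      using det_identical_rows[of ?A _ "length us" "Suc (length us)"] by simp
    then show ?thesis by (simp add: monomial_inner_def)
  qed (simp add: monomial_inner_def)
qed

text \<open>The bilinear extension of \<^const>\<open>monomial_inner\<close>.\<close>

definition free_inner :: "'a::real_inner free_algebra \<Rightarrow> 'a free_algebra \<Rightarrow> real"
  where "free_inner f g = free_extend (\<lambda>u. free_extend (\<lambda>w. monomial_inner u w) g) f"

lemma free_inner_add_left: "free_inner (f + f') g = free_inner f g + free_inner f' g"
  by (simp add: free_inner_def free_extend_add)

lemma free_inner_commute: "free_inner f g = free_inner g f"
  unfolding free_inner_def free_extend_def sum_distrib_left
  by (subst sum.swap) (simp add: monomial_inner_commute mult.left_commute)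

lemma free_inner_ideal: "f \<in> ext_ideal \<Longrightarrow> free_inner f g = 0"
proof (induction g rule: free_algebra_induct)
  case (single u c)
  have "free_inner f (Poly_Mapping.single u c) = c * free_extend (\<lambda>w. monomial_inner w u) f"
    by (simp add: free_inner_def free_extend_fun_scale)
  then show ?case
    using free_extend_ideal[OF alternating_monomial_inner single] by simp
next
  case (add g g')
  then show ?case by (metis add_0 free_inner_add_left free_inner_commute)
qed (simp add: free_inner_def free_extend_fun_0)

lift_definition ext_inner :: "'a::real_inner exterior \<Rightarrow> 'a exterior \<Rightarrow> real" is free_inner
proof -
  fix f f' g g' :: "'a free_algebra"
  assume "ext_rel f f'" "ext_rel g g'"
  then have "free_inner (f - f') g = 0" "free_inner (g - g') f' = 0"
    unfolding ext_rel_def by (simp_all add: free_inner_ideal)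
  then show "free_inner f g = free_inner f' g'"
    using free_inner_add_left[of "f - f'" f' g] free_inner_add_left[of "g - g'" g' f']
    by (simp add: free_inner_commute)
qed

lemma ext_inner_commute: "ext_inner \<alpha> \<beta> = ext_inner \<beta> \<alpha>"
  by transfer (rule free_inner_commute)

lemma linear_ext_inner_left: "linear (\<lambda>\<alpha>. ext_inner \<alpha> \<beta>)"
proof (rule linearI)
  show "ext_inner (\<alpha> + \<alpha>') \<beta> = ext_inner \<alpha> \<beta> + ext_inner \<alpha>' \<beta>" for \<alpha> \<alpha>'
    by transfer (rule free_inner_add_left)
  show "ext_inner (c *\<^sub>R \<alpha>) \<beta> = c *\<^sub>R ext_inner \<alpha> \<beta>" for c \<alpha>
    by transfer (simp add: free_inner_def free_extend_const_mult)
qed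

lemma linear_ext_inner_right: "linear (\<lambda>\<beta>. ext_inner \<alpha> \<beta>)"
  using linear_ext_inner_left[of \<alpha>] by (simp add: ext_inner_commute)

lemma ext_wedge_abs: "ext_wedge ws = abs_exterior (Poly_Mapping.single (Monomial ws) 1)"
proof (induction ws)
  case Nil
  then show ?case
    by (simp add: ext_wedge_def one_exterior.abs_eq flip: zero_monomial_def)
next
  case (Cons x ws)
  then show ?case
    by (simp add: ext_wedge_def ext_vec.abs_eq times_exterior.abs_eq free_gen_def mult_single
        plus_monomial_def)
qed

lemma ext_inner_wedge:
  "length us = length ws \<Longrightarrow> ext_inner (ext_wedge us) (ext_wedge ws) = det (gram us ws)"
  by (simp add: ext_wedge_abs ext_inner.abs_eq free_inner_def monomial_inner_def)

lemma ext_inner_vec: "ext_inner (ext_vec x) (ext_vec y) = inner x y"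
  using ext_inner_wedge[of "[x]" "[y]"] by (simp add: ext_wedge_def gram_def det_single)

lemma inj_ext_vec: "inj (ext_vec :: 'a::real_inner \<Rightarrow> 'a exterior)"
proof (rule injI)
  fix x y :: 'a
  assume "ext_vec x = ext_vec y"
  then have "inner x z = inner y z" for z
    by (metis ext_inner_vec)
  then have "inner (x - y) (x - y) = 0"
    by (simp add: inner_diff_left)
  then show "x = y" by simp
qed


section \<open>Orientation, volume form and Hodge star\<close>

text \<open>
  An orientation of an \<open>m\<close>-dimensional space \<open>W\<close> is one of the two open half-lines of
  \<open>\<and>\<^sup>m W - {0}\<close>; \<open>orientation_of bs\<close> is the one for which the ordered basis \<open>bs\<close> is positive.
\<close>

definition orientation_of :: "'a::real_vector list \<Rightarrow> 'a exterior set"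
  where "orientation_of bs = {c *\<^sub>R ext_wedge bs |c. 0 < c}"

definition volume_form :: "'a::real_inner exterior set \<Rightarrow> 'a exterior"
  where "volume_form ori = (THE \<omega>. \<omega> \<in> ori \<and> ext_inner \<omega> \<omega> = 1)"

definition hodge_star ::
  "'a::real_inner set \<Rightarrow> 'a exterior set \<Rightarrow> nat \<Rightarrow> 'a exterior \<Rightarrow> 'a exterior"
  where "hodge_star W ori p \<alpha> =
    (THE \<eta>. \<eta> \<in> ext_power (dim W - p) W \<and>
      (\<forall>\<beta> \<in> ext_power (dim W - p) W. ext_inner \<eta> \<beta> *\<^sub>R volume_form ori = \<alpha> * \<beta>))"


section \<open>Determinants\<close>

definition gram_det :: "(nat \<Rightarrow> 'a::real_inner) \<Rightarrow> nat \<Rightarrow> real"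
  where "gram_det v m = det (mat m m (\<lambda>(i, j). inner (v i) (v j)))"

text \<open>
  The formal cofactor expansion, along the last row, of the \<open>(k+1) \<times> (k+1)\<close> determinant whose
  first \<open>k\<close> rows are the real numbers \<open>a i j\<close> and whose last row consists of the vectors
  \<open>u 0, \<dots>, u k\<close>; rows and columns are numbered from \<open>0\<close>.
\<close>

definition det_last_row_vec ::
  "nat \<Rightarrow> (nat \<Rightarrow> nat \<Rightarrow> real) \<Rightarrow> (nat \<Rightarrow> 'a::real_vector) \<Rightarrow> 'a"
  where "det_last_row_vec k a u =
    (\<Sum>j\<le>k. ((-1) ^ (k + j) * det (mat k k (\<lambda>(i, l). a i (if l < j then l else Suc l)))) *\<^sub>R u j)"

end

theory Submission
  imports Defs
begin

text \<open>
  Let \<open>D\<close> be the vector given by the formal determinant.  Expanding along the last row shows that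
  \<open>\<langle>D, x\<rangle>\<close> is the numerical determinant whose last row is \<open>(\<langle>v\<^sub>0, x\<rangle>, \<dots>, \<langle>v\<^sub>k, x\<rangle>)\<close>.  So \<open>D\<close> is
  orthogonal to \<open>v\<^sub>0, \<dots>, v\<^sub>k\<^sub>-\<^sub>1\<close>, because two rows coincide, and \<open>\<langle>D, v\<^sub>k\<rangle>\<close> is the Gram determinant
  \<open>d = d\<^sub>k\<^sub>+\<^sub>1\<^sub>,\<^sub>k\<^sub>+\<^sub>1\<close> (lemma \<open>inner_gram_normal_basis\<close>).

  Since \<open>D\<close> is \<open>d\<^sub>k\<^sub>,\<^sub>k v\<^sub>k\<close> plus a combination of \<open>v\<^sub>0, \<dots>, v\<^sub>k\<^sub>-\<^sub>1\<close>, it satisfies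
  \<open>\<langle>D, D\<rangle> = d\<^sub>k\<^sub>,\<^sub>k d\<close>, which makes all Gram determinants of independent families positive by
  induction (lemma \<open>gram_det_pos\<close>).  Hence the volume form is \<open>\<Omega> = (v\<^sub>0 \<and> \<dots> \<and> v\<^sub>k) / \<surd>d\<close>.

  The codomain of the star operator is \<open>\<and>\<^sup>1 V\<^sub>k = V\<^sub>k\<close>, so it remains to compare, for \<open>x \<in> V\<^sub>k\<close>,
  \<open>\<langle>D / \<surd>d, x\<rangle> \<Omega> = (\<langle>D, x\<rangle> / d) v\<^sub>0 \<and> \<dots> \<and> v\<^sub>k\<close> with \<open>v\<^sub>0 \<and> \<dots> \<and> v\<^sub>k\<^sub>-\<^sub>1 \<and> x\<close>.  Both are linear in
  \<open>x\<close>; at \<open>x = v\<^sub>i\<close> with \<open>i < k\<close> both vanish, and at \<open>x = v\<^sub>k\<close> both equal \<open>v\<^sub>0 \<and> \<dots> \<and> v\<^sub>k\<close>.  A vector of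
  \<open>V\<^sub>k\<close> is determined by its inner products with \<open>V\<^sub>k\<close>, so no other vector has this property.
\<close>

section \<open>The formal Gram determinant as a normal vector\<close>

text \<open>A normal vector, inside \<open>V\<^sub>k\<close>, of the hyperplane spanned by \<open>v\<^sub>0, \<dots>, v\<^sub>k\<^sub>-\<^sub>1\<close>.\<close>

abbreviation gram_normal :: "nat \<Rightarrow> (nat \<Rightarrow> 'a::real_inner) \<Rightarrow> 'a"
  where "gram_normal k v \<equiv> det_last_row_vec k (\<lambda>i j. inner (v j) (v i)) v"

lemma inner_det_last_row_vec:
  "inner (det_last_row_vec k a u) x =
    det (mat (Suc k) (Suc k) (\<lambda>(i, j). if i < k then a i j else inner (u j) x))"
  (is "_ = det ?A")
proof -
  have del: "mat_delete ?A k j = mat k k (\<lambda>(i, l). a i (if l < j then l else Suc l))"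
    if "j \<le> k" for j
    unfolding mat_delete_def by (rule eq_matI) auto
  have "det ?A = (\<Sum>j<Suc k. ?A $$ (k, j) * cofactor ?A k j)"
    by (rule laplace_expansion_row) auto
  also have "\<dots> = (\<Sum>j\<le>k.
      (-1) ^ (k + j) * det (mat k k (\<lambda>(i, l). a i (if l < j then l else Suc l))) * inner (u j) x)"
    unfolding lessThan_Suc_atMost
    by (rule sum.cong) (simp_all add: cofactor_def del)
  finally show ?thesis
    by (simp add: det_last_row_vec_def inner_sum_left)
qed

lemma inner_gram_normal_basis:
  assumes "i \<le> k"
  shows "inner (gram_normal k v) (v i) = (if i = k then gram_det v (Suc k) else 0)"
proof (cases "i = k")
  case True
  have "mat (Suc k) (Suc k) (\<lambda>(i, j). if i < k then inner (v j) (v i) else inner (v j) (v k)) =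
      mat (Suc k) (Suc k) (\<lambda>(i, j). inner (v i) (v j))"
    by (rule eq_matI) (auto simp: less_Suc_eq inner_commute)
  then show ?thesis
    using True by (simp add: inner_det_last_row_vec gram_det_def)
next
  case False
  let ?A = "mat (Suc k) (Suc k)
    (\<lambda>(l, j). if l < k then inner (v j) (v l) else inner (v j) (v i))"
  have "row ?A i = row ?A k"
    by (rule eq_vecI) (use assms False in auto)
  then have "det ?A = 0"
    using det_identical_rows[of ?A "Suc k" i k] assms False by simp
  then show ?thesis
    using False by (simp add: inner_det_last_row_vec)
qed

lemma gram_normal_decomposition:
  "\<exists>r \<in> span (v ` {..<k}). gram_normal k v = gram_det v k *\<^sub>R v k + r"
proof
  let ?t = "\<lambda>j. ((-1) ^ (k + j) *
    det (mat k k (\<lambda>(i, l). inner (v (if l < j then l else Suc l)) (v i)))) *\<^sub>R v j"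
  show "sum ?t {..<k} \<in> span (v ` {..<k})"
    by (intro span_sum span_scale span_base) auto
  have "mat k k (\<lambda>(i, l). inner (v (if l < k then l else Suc l)) (v i)) =
      mat k k (\<lambda>(i, j). inner (v i) (v j))"
    by (rule eq_matI) (auto simp: inner_commute)
  then have "?t k = gram_det v k *\<^sub>R v k"
    by (simp add: gram_det_def)
  then show "gram_normal k v = gram_det v k *\<^sub>R v k + sum ?t {..<k}"
    unfolding det_last_row_vec_def lessThan_Suc_atMost[symmetric] sum.lessThan_Suc
    by (simp add: add.commute)
qed

lemma gram_normal_in_span: "gram_normal k v \<in> span (v ` {..k})"
  unfolding det_last_row_vec_def by (intro span_sum span_scale span_base) auto

text \<open>
  Positivity comes from \<open>0 < \<langle>D, D\<rangle> = d\<^sub>k\<^sub>,\<^sub>k \<langle>D, v\<^sub>k\<rangle> = d\<^sub>k\<^sub>,\<^sub>k d\<^sub>k\<^sub>+\<^sub>1\<^sub>,\<^sub>k\<^sub>+\<^sub>1\<close>: only the last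
  component of \<open>D\<close> contributes to \<open>\<langle>D, D\<rangle>\<close>, and by the induction hypothesis its coefficient
  \<open>d\<^sub>k\<^sub>,\<^sub>k\<close> is positive, so that \<open>D\<close> is nonzero by independence.
\<close>

lemma gram_det_pos:
  fixes v :: "nat \<Rightarrow> 'a::real_inner"
  assumes "inj_on v {..<m}" and "independent (v ` {..<m})"
  shows "0 < gram_det v m"
  using assms
proof (induction m)
  case 0
  show ?case by (simp add: gram_det_def)
next
  case (Suc k)
  let ?D = "gram_normal k v"
  have pos: "0 < gram_det v k"
  proof (rule Suc.IH)
    show "inj_on v {..<k}"
      using Suc.prems(1) by (rule inj_on_subset) auto
    show "independent (v ` {..<k})"
      using Suc.prems(2) by (rule independent_mono) auto
  qed
  obtain r where r: "r \<in> span (v ` {..<k})" and D: "?D = gram_det v k *\<^sub>R v k + r"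
    using gram_normal_decomposition by blast
  have "?D \<noteq> 0"
  proof
    assume "?D = 0"
    then have "gram_det v k *\<^sub>R v k = - r"
      using D by (simp add: eq_neg_iff_add_eq_0)
    then have "v k = (1 / gram_det v k) *\<^sub>R (- r)"
      using pos by (metis divide_self_if less_irrefl scaleR_one scaleR_scaleR times_divide_eq_left mult_1)
    then have "v k \<in> span (v ` {..<k})"
      using r by (metis span_neg span_scale)
    moreover have "v ` {..<k} \<subseteq> v ` {..<Suc k} - {v k}"
      using Suc.prems(1) by (auto dest: inj_onD)
    ultimately have "v k \<in> span (v ` {..<Suc k} - {v k})"
      using span_mono by blast
    then show False
      using Suc.prems(2) unfolding dependent_def by blast
  qed
  have "inner ?D x = 0" if "x \<in> span (v ` {..<k})" for x
    using that
  proof (induction rule: span_induct_alt)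
    case (step c x y)
    then show ?case
      using inner_gram_normal_basis[of _ k v] by (auto simp: inner_add_right)
  qed simp
  then have "inner ?D ?D = gram_det v k * gram_det v (Suc k)"
    using r inner_gram_normal_basis[of k k v]
    by (subst (2) D) (simp add: inner_add_right)
  moreover have "0 < inner ?D ?D"
    using \<open>?D \<noteq> 0\<close> by simp
  ultimately show ?case
    using pos by (simp add: zero_less_mult_iff)
qed

section \<open>Wedge products with a repeated factor\<close>

text \<open>Polarising \<open>(x + y) \<and> (x + y) = 0\<close>.\<close>

lemma ext_vec_anticommute: "ext_vec x * ext_vec y = - (ext_vec y * ext_vec x)"
proof -
  have "ext_vec (x + y) * ext_vec (x + y) = ext_vec x * ext_vec y + ext_vec y * ext_vec x"
    by (simp add: linear_add[OF linear_ext_vec] distrib_left distrib_right ext_vec_square)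
  then show ?thesis
    by (simp add: ext_vec_square eq_neg_iff_add_eq_0)
qed

lemma ext_vec_mult_wedge:
  "ext_vec x * ext_wedge ws = (-1) ^ length ws *\<^sub>R (ext_wedge ws * ext_vec x)"
proof (induction ws)
  case (Cons y ws)
  have "ext_vec x * ext_wedge (y # ws) = - (ext_vec y * (ext_vec x * ext_wedge ws))"
    by (simp add: ext_wedge_def ext_vec_anticommute[of x y] flip: mult.assoc)
  also have "\<dots> = (-1) ^ length (y # ws) *\<^sub>R (ext_vec y * (ext_wedge ws * ext_vec x))"
    unfolding Cons.IH by simp
  finally show ?case
    by (simp add: mult.assoc ext_wedge_def)
qed (simp add: ext_wedge_def)

lemma ext_wedge_mult_member:
  assumes "x \<in> set ws" shows "ext_wedge ws * ext_vec x = 0"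
  using assms
proof (induction ws)
  case (Cons y ws)
  have split: "ext_wedge (y # ws) * ext_vec x = ext_vec y * (ext_wedge ws * ext_vec x)"
    by (simp add: ext_wedge_def mult.assoc)
  show ?case
  proof (cases "x \<in> set ws")
    case True
    then show ?thesis using Cons.IH split by simp
  next
    case False
    then have "y = x" using Cons.prems by simp
    have "ext_wedge ws * ext_vec x = (-1) ^ length ws *\<^sub>R (ext_vec x * ext_wedge ws)"
      by (simp add: ext_vec_mult_wedge flip: power_mult_distrib)
    then have "ext_wedge (y # ws) * ext_vec x =
        (-1) ^ length ws *\<^sub>R ((ext_vec x * ext_vec x) * ext_wedge ws)"
      unfolding split by (simp add: \<open>y = x\<close> mult.assoc)
    then show ?thesis
      by (simp add: ext_vec_square)
  qed
qed simp

lemma ext_wedge_snoc: "ext_wedge (ws @ [x]) = ext_wedge ws * ext_vec x"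
  by (simp add: ext_wedge_def)

section \<open>Volume form and Hodge star in codegree one\<close>

lemma ext_wedge_square_norm:
  "ext_inner (ext_wedge (map v [0..<m])) (ext_wedge (map v [0..<m])) = gram_det v m"
proof -
  have "gram (map v [0..<m]) (map v [0..<m]) = mat m m (\<lambda>(i, j). inner (v i) (v j))"
    unfolding gram_def by (rule eq_matI) auto
  then show ?thesis
    by (simp add: ext_inner_wedge gram_det_def)
qed

lemma volume_form_orientation_of:
  assumes pos: "0 < ext_inner (ext_wedge bs) (ext_wedge bs)"
  shows "volume_form (orientation_of bs) =
    (1 / sqrt (ext_inner (ext_wedge bs) (ext_wedge bs))) *\<^sub>R ext_wedge bs"
proof -
  define d where "d = ext_inner (ext_wedge bs) (ext_wedge bs)"
  have d: "0 < d" using pos by (simp add: d_def)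
  have norm: "ext_inner (c *\<^sub>R ext_wedge bs) (c *\<^sub>R ext_wedge bs) = c * c * d" for c
    by (simp add: d_def linear_scale[OF linear_ext_inner_left] linear_scale[OF linear_ext_inner_right])
  show ?thesis
    unfolding volume_form_def d_def[symmetric]
  proof (rule the_equality)
    show "(1 / sqrt d) *\<^sub>R ext_wedge bs \<in> orientation_of bs \<and>
        ext_inner ((1 / sqrt d) *\<^sub>R ext_wedge bs) ((1 / sqrt d) *\<^sub>R ext_wedge bs) = 1"
      unfolding norm using d by (auto simp: orientation_of_def)
  next
    fix \<omega> assume \<omega>: "\<omega> \<in> orientation_of bs \<and> ext_inner \<omega> \<omega> = 1"
    then obtain c where c: "0 < c" "\<omega> = c *\<^sub>R ext_wedge bs"
      by (auto simp: orientation_of_def)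
    then have "c * c * d = 1"
      using \<omega> norm[of c] by simp
    then have "(c * sqrt d)\<^sup>2 = 1"
      using d by (simp add: power_mult_distrib flip: power2_eq_square)
    then have "c * sqrt d = 1"
      using c d by (simp add: power2_eq_1_iff) (smt (verit) mult_pos_pos real_sqrt_gt_zero)
    then have "c = 1 / sqrt d"
      using d by (simp add: field_simps)
    then show "\<omega> = (1 / sqrt d) *\<^sub>R ext_wedge bs"
      using c by simp
  qed
qed

text \<open>
  In codegree one the star operator takes values in \<open>\<and>\<^sup>1 W\<close>, which is \<open>W\<close> itself; uniqueness is
  then the nondegeneracy of the inner product on \<open>W\<close>.
\<close>

lemma hodge_star_codegree_1_eqI:
  fixes W :: "'a::real_inner set"
  assumes W: "subspace W" and dim: "dim W - p = 1" and "y \<in> W"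
    and \<Omega>: "volume_form ori \<noteq> 0"
    and eq: "\<And>x. x \<in> W \<Longrightarrow> inner y x *\<^sub>R volume_form ori = \<alpha> * ext_vec x"
  shows "hodge_star W ori p \<alpha> = ext_vec y"
  unfolding hodge_star_def dim ext_power_1[OF W]
proof (rule the_equality)
  show "ext_vec y \<in> ext_vec ` W \<and>
      (\<forall>\<beta>\<in>ext_vec ` W. ext_inner (ext_vec y) \<beta> *\<^sub>R volume_form ori = \<alpha> * \<beta>)"
    using \<open>y \<in> W\<close> eq by (auto simp: ext_inner_vec)
next
  fix \<eta>
  assume \<eta>: "\<eta> \<in> ext_vec ` W \<and>
      (\<forall>\<beta>\<in>ext_vec ` W. ext_inner \<eta> \<beta> *\<^sub>R volume_form ori = \<alpha> * \<beta>)"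
  then obtain z where z: "z \<in> W" "\<eta> = ext_vec z" by blast
  have "inner z x = inner y x" if "x \<in> W" for x
  proof -
    have "inner z x *\<^sub>R volume_form ori = inner y x *\<^sub>R volume_form ori"
      using \<eta> z eq that by (auto simp: ext_inner_vec)
    then show ?thesis using \<Omega> by simp
  qed
  moreover have "z - y \<in> W"
    using W z(1) \<open>y \<in> W\<close> by (simp add: subspace_diff)
  ultimately have "inner (z - y) (z - y) = 0"
    by (simp add: inner_diff_left)
  then show "\<eta> = ext_vec y" using z by simp
qed

section \<open>The Hodge star of a wedge product of basis vectors\<close>

theorem mainTheorem5:
  fixes v :: "nat \<Rightarrow> 'a::real_inner" and n k :: nat
  assumes "inj_on v {..n}" and "independent (v ` {..n})"
    and "1 \<le> k" and "k \<le> n"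
  shows "hodge_star (span (v ` {..k})) (orientation_of (map v [0..<Suc k])) k
           (ext_wedge (map v [0..<k])) =
         ext_vec ((1 / sqrt (gram_det v (Suc k))) *\<^sub>R
           det_last_row_vec k (\<lambda>i j. inner (v j) (v i)) v)"
proof -
  let ?D = "gram_normal k v" and ?bs = "map v [0..<Suc k]"
  define d where "d = gram_det v (Suc k)"
  have inj: "inj_on v {..k}"
    using assms(1) by (rule inj_on_subset) (use assms(4) in auto)
  have ind: "independent (v ` {..k})"
    using assms(2) by (rule independent_mono) (use assms(4) in auto)
  have d: "0 < d"
    unfolding d_def using gram_det_pos[of v "Suc k"] inj ind
    by (simp add: lessThan_Suc_atMost)
  have norm: "ext_inner (ext_wedge ?bs) (ext_wedge ?bs) = d"
    unfolding d_def by (rule ext_wedge_square_norm)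
  have vol: "volume_form (orientation_of ?bs) = (1 / sqrt d) *\<^sub>R ext_wedge ?bs"
    using volume_form_orientation_of[of ?bs] d unfolding norm by simp
  have "ext_wedge ?bs \<noteq> 0"
    using norm d linear_0[OF linear_ext_inner_left] by (metis less_irrefl)
  have snoc: "ext_wedge ?bs = ext_wedge (map v [0..<k]) * ext_vec (v k)"
    by (simp add: ext_wedge_snoc)
  have basis: "(inner ?D (v i) / d) *\<^sub>R ext_wedge ?bs = ext_wedge (map v [0..<k]) * ext_vec (v i)"
    if "i \<le> k" for i
  proof (cases "i = k")
    case True
    then show ?thesis
      using inner_gram_normal_basis[of k k v] d by (simp only: snoc) (simp add: d_def)
  next
    case False
    then have "v i \<in> set (map v [0..<k])" using that by auto
    then show ?thesis
      using inner_gram_normal_basis[OF that, of v] False by (simp only: ext_wedge_mult_member) simp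
  qed
  have wedge: "(inner ?D x / d) *\<^sub>R ext_wedge ?bs = ext_wedge (map v [0..<k]) * ext_vec x"
    if "x \<in> span (v ` {..k})" for x
    using that
  proof (induction rule: span_induct_alt)
    case base
    show ?case by (simp add: linear_0[OF linear_ext_vec])
  next
    case (step c x y)
    then have x: "(inner ?D x / d) *\<^sub>R ext_wedge ?bs = ext_wedge (map v [0..<k]) * ext_vec x"
      using basis by auto
    have "(inner ?D (c *\<^sub>R x + y) / d) *\<^sub>R ext_wedge ?bs =
        c *\<^sub>R ((inner ?D x / d) *\<^sub>R ext_wedge ?bs) + (inner ?D y / d) *\<^sub>R ext_wedge ?bs"
      by (simp only: inner_add_right inner_scaleR_right add_divide_distrib scaleR_add_left
          scaleR_scaleR times_divide_eq_right)
    also have "\<dots> = ext_wedge (map v [0..<k]) * ext_vec (c *\<^sub>R x + y)"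
      unfolding x step.IH
      by (simp only: linear_add[OF linear_ext_vec] linear_scale[OF linear_ext_vec]
          distrib_left mult_scaleR_right)
    finally show ?case .
  qed
  show ?thesis
    unfolding d_def[symmetric]
  proof (rule hodge_star_codegree_1_eqI)
    show "dim (span (v ` {..k})) - k = 1"
      using dim_eq_card_independent[OF ind] card_image[OF inj] by simp
    show "(1 / sqrt d) *\<^sub>R ?D \<in> span (v ` {..k})"
      by (rule span_scale[OF gram_normal_in_span])
    show "volume_form (orientation_of ?bs) \<noteq> 0"
      unfolding vol using \<open>ext_wedge ?bs \<noteq> 0\<close> d by simp
    fix x assume x: "x \<in> span (v ` {..k})"
    have "inner ((1 / sqrt d) *\<^sub>R ?D) x *\<^sub>R volume_form (orientation_of ?bs) =
        (inner ?D x / d) *\<^sub>R ext_wedge ?bs"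
      unfolding vol using d by (simp del: upt_Suc)
    also have "\<dots> = ext_wedge (map v [0..<k]) * ext_vec x"
      by (rule wedge[OF x])
    finally show "inner ((1 / sqrt d) *\<^sub>R ?D) x *\<^sub>R volume_form (orientation_of ?bs) =
        ext_wedge (map v [0..<k]) * ext_vec x" .
  qed simp
qed

end
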